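(* Let $n\ge 2$ and let $S$ be a subset of $\mathbb{Z}_n$ such that $$S=\begin{cases}\emptyset & \text{if } n\not\equiv 0\pmod 3,\\ \bigcup_{d\in\mathscr{D}}S_n(d) & \text{if } n\equiv 0\pmod 3,\end{cases}$$ where $\mathscr{D}\subseteq\{d: d\mid\frac n3\}$ and $S_n(d)\in\{G_{n,3}^1(d),G_{n,3}^2(d)\}$ for each $d\in\mathscr{D}$. Then the oriented circulant graph $\mathrm{Circ}(\mathbb{Z}_n,S)$ is HS-integral.
   Context: Elements of $\mathbb{Z}_n$ are identified with $0,1,\dots,n-1$. The graph $\mathrm{Circ}(\mathbb{Z}_n,S)$ has vertex set $\mathbb{Z}_n$ and directed edge set $\{(a,b): b-a\in S\}$; it is oriented when $-a\notin S$ for all $a\in S$. Its Hermitian-adjacency matrix of the second kind is $\mathcal{H}=(h_{uv})$ with $h_{uv}=1$ if both $(u,v)$ and $(v,u)$ are edges, $h_{uv}=\frac{1+i\sqrt3}{2}$ if only $(u,v)$ is an edge, $h_{uv}=\frac{1-i\sqrt3}{2}$ if only $(v,u)$ is an edge, and $h_{uv}=0$ otherwise. The graph is HS-integral if all eigenvalues of $\mathcal{H}$ are integers. For $n\equiv 0\pmod 3$, a positive divisor $d$ of $\frac n3$ and $r\in\{1,2\}$, $G_{n,3}^r(d)=\{dk: 1\le dk\le n-1,\ \gcd(dk,n)=d,\ k\equiv r\pmod 3\}$. *)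

theory Defs
  imports
    Complex_Main
    "HOL-Number_Theory.Cong"
    "Graph_Theory.Pair_Digraph"
    "Jordan_Normal_Form.Char_Poly"
begin

text \<open>The elements of $\mathbb{Z}_n$ are represented by the natural numbers below $n$; the
  difference and the negative are computed in the integers and reduced modulo $n$, because
  subtraction of natural numbers truncates.\<close>

definition zn_diff :: "nat \<Rightarrow> nat \<Rightarrow> nat \<Rightarrow> nat" where
  "zn_diff n b a = nat ((int b - int a) mod int n)"

definition zn_neg :: "nat \<Rightarrow> nat \<Rightarrow> nat" where
  "zn_neg n a = nat ((- int a) mod int n)"

definition circ :: "nat \<Rightarrow> nat set \<Rightarrow> nat pair_pre_digraph" where
  "circ n S = \<lparr> pverts = {0..<n},
                parcs = {(a, b). a \<in> {0..<n} \<and> b \<in> {0..<n} \<and> zn_diff n b a \<in> S} \<rparr>"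

text \<open>A property of the connection set: Circ$(\mathbb{Z}_n,S)$ is called oriented when it holds.\<close>

definition circ_oriented :: "nat \<Rightarrow> nat set \<Rightarrow> bool" where
  "circ_oriented n S \<longleftrightarrow> (\<forall>a\<in>S. zn_neg n a \<notin> S)"

text \<open>Matrix rows and columns are indexed by initial segments of the natural numbers, so this is
  meaningful for digraphs whose vertex set is such a segment.\<close>

definition HS_matrix :: "nat pair_pre_digraph \<Rightarrow> complex mat" where
  "HS_matrix G = mat (card (pverts G)) (card (pverts G)) (\<lambda>(u, v).
     if (u, v) \<in> parcs G \<and> (v, u) \<in> parcs G then 1
     else if (u, v) \<in> parcs G then (1 + \<i> * complex_of_real (sqrt 3)) / 2
     else if (v, u) \<in> parcs G then (1 - \<i> * complex_of_real (sqrt 3)) / 2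
     else 0)"

definition HS_integral :: "nat pair_pre_digraph \<Rightarrow> bool" where
  "HS_integral G \<longleftrightarrow> (\<forall>x. eigenvalue (HS_matrix G) x \<longrightarrow> x \<in> \<int>)"

text \<open>$G_{n,3}^r(d)$, for $3 \mid n$, $d \mid n/3$ and $r\in\{1,2\}$.\<close>

definition G3 :: "nat \<Rightarrow> nat \<Rightarrow> nat \<Rightarrow> nat set" where
  "G3 n r d = {d * k | k. 1 \<le> d * k \<and> d * k \<le> n - 1 \<and> gcd (d * k) n = d \<and> [k = r] (mod 3)}"

end

theory Submission
  imports Defs
begin

text \<open>
  The Hermitian-adjacency matrix of a circulant digraph is a circulant matrix: its \<open>(u, v)\<close>
  entry is a fixed function (the symbol) of \<open>v - u\<close> modulo \<open>n\<close>. The additive characters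
  of \<open>\<int>\<^sub>n\<close> are left eigenvectors of every circulant matrix, and since a nonzero vector has a
  nonzero Fourier coefficient, every eigenvalue is a Fourier coefficient of the symbol
  (\<open>eigenvalue_circulant\<close>).

  The Fourier coefficients of the symbol are integers for the following reason. Write
  \<open>s = d k\<close> with \<open>d = gcd s n\<close> one of the chosen divisors. Then 3 divides \<open>n div d\<close>, so
  \<open>k\<close> is prime to 3, and exactly one of \<open>s\<close> and \<open>-s\<close> lies in the connection set, according to
  whether \<open>k\<close> is congruent to \<open>r\<close> or to \<open>-r\<close> modulo 3. This gives orientedness. With
  \<open>\<omega> = cis (2 \<pi> / 3)\<close>, the two matrix entries \<open>(1 \<plusminus> \<i> \<surd>3) / 2\<close>
  are minus the two primitive cube roots of unity, and both cases are captured by a single formula: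
  the symbol at \<open>s\<close> is \<open>- (\<omega> powi (- r k))\<close> (\<open>HS_symbol_eq\<close>).
  So on each gcd class the symbol, as a function of \<open>k\<close>, is minus a character of the cofactor
  group \<open>\<int>\<^sub>m\<close>, \<open>m = n div d\<close>. Multiplying by another character only shifts the frequency, so the
  class contributes minus the sum of a character over the units of \<open>\<int>\<^sub>m\<close>, which is a Ramanujan
  sum. Ramanujan sums are integers (\<open>ramanujan_sum_in_Ints\<close>), hence so is every eigenvalue.
\<close>

section \<open>Roots of unity\<close>

definition unit_root :: "nat \<Rightarrow> int \<Rightarrow> complex" where
  "unit_root n j = cis (2 * pi * of_int j / of_nat n)"

lemma unit_root_add: "unit_root n (i + j) = unit_root n i * unit_root n j"
  by (simp add: unit_root_def cis_mult add_divide_distrib distrib_left)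

lemma unit_root_0 [simp]: "unit_root n 0 = 1"
  by (simp add: unit_root_def)

lemma unit_root_power: "unit_root n j ^ k = unit_root n (j * int k)"
  by (simp add: unit_root_def Complex.DeMoivre mult_ac)

lemma unit_root_eq_1_iff:
  assumes "n > 0"
  shows "unit_root n j = 1 \<longleftrightarrow> int n dvd j"
proof
  assume "unit_root n j = 1"
  then have "cos (2 * pi * of_int j / of_nat n) = 1"
    by (metis unit_root_def cis.simps(1) one_complex.simps(1))
  then obtain k :: int where k: "2 * pi * of_int j / of_nat n = of_int k * 2 * pi"
    by (auto simp: cos_one_2pi_int)
  then have "(of_int j :: real) = of_int (k * int n)"
    using assms by (simp add: field_simps)
  then have "j = k * int n"
    by (simp only: of_int_eq_iff)
  then show "int n dvd j"
    by simp
next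
  assume "int n dvd j"
  then obtain k where "j = int n * k" ..
  then have "2 * pi * of_int j / of_nat n = 2 * pi * (of_int k :: real)"
    using assms by simp
  then show "unit_root n j = 1"
    by (simp add: unit_root_def)
qed

lemma unit_root_cong:
  assumes "n > 0" "[i = j] (mod int n)"
  shows "unit_root n i = unit_root n j"
proof -
  have "unit_root n i = unit_root n (j + (i - j))"
    by simp
  also have "\<dots> = unit_root n j * unit_root n (i - j)"
    by (rule unit_root_add)
  also have "unit_root n (i - j) = 1"
    using assms by (simp add: unit_root_eq_1_iff cong_iff_dvd_diff)
  finally show ?thesis by simp
qed

lemma unit_root_cancel:
  assumes "d > 0" "d dvd n"
  shows "unit_root n (int d * j) = unit_root (n div d) j"
  using assms by (auto simp: unit_root_def mult.assoc elim!: dvdE)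

lemma sum_unit_root:
  assumes "n > 0"
  shows "(\<Sum>k<n. unit_root n (j * int k)) = (if int n dvd j then of_nat n else 0)"
proof -
  have eq: "(\<Sum>k<n. unit_root n (j * int k)) = (\<Sum>k<n. unit_root n j ^ k)"
    by (simp add: unit_root_power)
  have "unit_root n j ^ n = 1"
    using assms by (simp add: unit_root_power unit_root_eq_1_iff)
  then show ?thesis
    using assms by (auto simp: eq unit_root_eq_1_iff sum_gp_strict)
qed

section \<open>Ramanujan sums\<close>

definition ramanujan_sum :: "nat \<Rightarrow> int \<Rightarrow> complex" where
  "ramanujan_sum n j = (\<Sum>k | k < n \<and> coprime k n. unit_root n (j * int k))"

text \<open>The numbers below \<open>n\<close> with \<open>gcd s n = d\<close> are the multiples \<open>d k\<close> with \<open>k\<close> running through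
  the units modulo the cofactor \<open>n div d\<close>. For \<open>d = n\<close> this is \<open>s = 0\<close>, matching the convention
  that 0 is a unit modulo 1.\<close>

lemma sum_gcd_class:
  fixes f :: "nat \<Rightarrow> 'a :: comm_monoid_add"
  assumes "n > 0" "d dvd n"
  shows "(\<Sum>s | s < n \<and> gcd s n = d. f s) = (\<Sum>k | k < n div d \<and> coprime k (n div d). f (d * k))"
proof (rule sum.reindex_bij_witness[of _ "\<lambda>k. d * k" "\<lambda>s. s div d"])
  have d: "d > 0" and n: "n = d * (n div d)"
    using assms by (auto intro: dvd_pos_nat)
  fix s assume s: "s \<in> {s. s < n \<and> gcd s n = d}"
  then have sd: "d * (s div d) = s" by auto
  then show "d * (s div d) = s" "f (d * (s div d)) = f s" by simp_all
  have "s div d < n div d"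
    using s sd n d by (metis (lifting) mem_Collect_eq nat_mult_less_cancel1)
  moreover have "coprime (s div d) (n div d)"
    using s d by (metis (lifting) div_gcd_coprime gcd_eq_0_iff mem_Collect_eq less_irrefl)
  ultimately show "s div d \<in> {k. k < n div d \<and> coprime k (n div d)}" by simp
next
  have d: "d > 0" and n: "n = d * (n div d)"
    using assms by (auto intro: dvd_pos_nat)
  fix k assume k: "k \<in> {k. k < n div d \<and> coprime k (n div d)}"
  show "d * k div d = k" using d by simp
  have "d * k < n" using k d n by (metis (lifting) mem_Collect_eq nat_mult_less_cancel1)
  moreover have "gcd (d * k) n = d"
  proof -
    have "gcd (d * k) n = gcd (d * k) (d * (n div d))" using n by simp
    also have "\<dots> = d * gcd k (n div d)" by (simp add: gcd_mult_distrib_nat)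
    finally show ?thesis using k by simp
  qed
  ultimately show "d * k \<in> {s. s < n \<and> gcd s n = d}" by simp
qed

lemma sum_unit_root_gcd_class:
  assumes "n > 0" "d dvd n"
  shows "(\<Sum>s | s < n \<and> gcd s n = d. unit_root n (j * int s)) = ramanujan_sum (n div d) j"
proof -
  have "unit_root n (j * int (d * k)) = unit_root (n div d) (j * int k)" for k
    using unit_root_cancel[of d n "j * int k"] assms by (simp add: mult_ac dvd_pos_nat)
  then show ?thesis
    using assms by (simp add: sum_gcd_class ramanujan_sum_def)
qed

text \<open>Sorting all residues by their gcd with \<open>n\<close> splits a complete character sum, whose value is known by
  orthogonality, into Ramanujan sums.\<close>

lemma sum_ramanujan_sum:
  assumes "n > 0"
  shows "(\<Sum>d | d dvd n. ramanujan_sum (n div d) j) = (if int n dvd j then of_nat n else 0)"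
proof -
  have "(\<Sum>d | d dvd n. ramanujan_sum (n div d) j)
      = (\<Sum>d | d dvd n. \<Sum>s | s \<in> {..<n} \<and> gcd s n = d. unit_root n (j * int s))"
    using assms by (intro sum.cong) (simp_all add: sum_unit_root_gcd_class)
  also have "\<dots> = (\<Sum>s<n. unit_root n (j * int s))"
    using assms by (intro sum.group) auto
  finally show ?thesis
    using assms by (simp add: sum_unit_root)
qed

text \<open>In the divisor-sum identity, the term for \<open>d = 1\<close> is the Ramanujan sum modulo \<open>n\<close> and all
  others have a smaller modulus; as the total is an integer, strong induction applies.\<close>

lemma ramanujan_sum_in_Ints:
  assumes "n > 0"
  shows "ramanujan_sum n j \<in> \<int>"
  using assms
proof (induction n rule: less_induct)
  case (less n)
  have fin: "finite {d. d dvd n}" using less.prems by simp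
  have "ramanujan_sum n j + (\<Sum>d\<in>{d. d dvd n} - {1}. ramanujan_sum (n div d) j)
      = (\<Sum>d | d dvd n. ramanujan_sum (n div d) j)"
    by (subst sum.remove[OF fin, of 1]) simp_all
  also have "\<dots> \<in> \<int>"
    using less.prems by (simp add: sum_ramanujan_sum)
  finally have "ramanujan_sum n j + (\<Sum>d\<in>{d. d dvd n} - {1}. ramanujan_sum (n div d) j) \<in> \<int>" .
  moreover have "(\<Sum>d\<in>{d. d dvd n} - {1}. ramanujan_sum (n div d) j) \<in> \<int>"
  proof (rule Ints_sum)
    fix d assume "d \<in> {d. d dvd n} - {1}"
    then have "1 < d" "d dvd n"
      using less.prems by (auto simp: nat_neq_iff)
    then show "ramanujan_sum (n div d) j \<in> \<int>"
      using less.prems by (intro less.IH) (auto intro: dvd_imp_le dvd_pos_nat simp: div_greater_zero_iff)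
  qed
  ultimately show ?case
    by (metis Ints_diff add_diff_cancel_right')
qed

section \<open>Eigenvalues of circulant matrices\<close>

lemma zn_diff_less: "n > 0 \<Longrightarrow> zn_diff n b a < n"
  by (simp add: zn_diff_def nat_less_iff)

lemma int_zn_diff: "n > 0 \<Longrightarrow> int (zn_diff n b a) = (int b - int a) mod int n"
  by (simp add: zn_diff_def)

lemma zn_diff_zn_diff:
  assumes "a < n"
  shows "zn_diff n b (zn_diff n b a) = a"
proof -
  have "int (zn_diff n b (zn_diff n b a)) = (int b - (int b - int a)) mod int n"
    using assms by (simp add: int_zn_diff mod_simps)
  then show ?thesis using assms by simp
qed

text \<open>Fourier inversion: the value at \<open>w\<close>, multiplied by \<open>n\<close>, is recovered from the Fourier
  coefficients by orthogonality of characters.\<close>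

lemma dft_eq_zero_imp_zero:
  assumes "w < n" and zero: "\<And>j. j < n \<Longrightarrow> (\<Sum>u<n. unit_root n (int j * int u) * f u) = 0"
  shows "f w = 0"
proof -
  have n: "n > 0" using assms(1) by simp
  have orth: "(\<Sum>j<n. unit_root n ((int u - int w) * int j)) = (if u = w then of_nat n else 0)"
    if "u < n" for u
  proof -
    have "int n dvd int u - int w \<longleftrightarrow> u = w"
      using that assms(1) by (metis cong_iff_dvd_diff cong_int_iff cong_less_modulus_unique_nat cong_refl)
    then show ?thesis using sum_unit_root[OF n, of "int u - int w"] by simp
  qed
  have "0 = (\<Sum>j<n. unit_root n (- int w * int j) * (\<Sum>u<n. unit_root n (int j * int u) * f u))"
    using zero by simp
  also have "\<dots> = (\<Sum>j<n. \<Sum>u<n. unit_root n ((int u - int w) * int j) * f u)"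
    by (simp add: sum_distrib_left mult.assoc[symmetric] flip: unit_root_add)
      (simp add: algebra_simps)
  also have "\<dots> = (\<Sum>u<n. (\<Sum>j<n. unit_root n ((int u - int w) * int j)) * f u)"
    by (subst sum.swap) (simp add: sum_distrib_right)
  also have "\<dots> = (\<Sum>u<n. if u = w then of_nat n * f u else 0)"
    by (intro sum.cong) (simp_all add: orth)
  also have "\<dots> = of_nat n * f w"
    using assms(1) by simp
  finally show ?thesis using n by simp
qed

text \<open>Substituting \<open>s = v - u\<close> turns column \<open>v\<close> of the matrix into a multiple of the character
  value at \<open>v\<close>, with a factor that is independent of \<open>v\<close>.\<close>

lemma circulant_left_eigenvector:
  assumes "v < n"
  shows "(\<Sum>u<n. unit_root n (j * int u) * c (zn_diff n v u))
    = (\<Sum>s<n. c s * unit_root n (- j * int s)) * unit_root n (j * int v)"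
proof -
  have n: "n > 0" using assms by simp
  have "(\<Sum>u<n. unit_root n (j * int u) * c (zn_diff n v u))
      = (\<Sum>s<n. c s * unit_root n (- j * int s) * unit_root n (j * int v))"
  proof (rule sum.reindex_bij_witness[of _ "zn_diff n v" "zn_diff n v"])
    fix u assume u: "u \<in> {..<n}"
    have "[- j * int (zn_diff n v u) + j * int v = - j * (int v - int u) + j * int v] (mod int n)"
      using n by (intro cong_add cong_mult) (simp_all add: int_zn_diff cong_def)
    then have "[- j * int (zn_diff n v u) + j * int v = j * int u] (mod int n)"
      by (simp add: algebra_simps)
    then have "unit_root n (- j * int (zn_diff n v u) + j * int v) = unit_root n (j * int u)"
      using n by (rule unit_root_cong[rotated])
    then show "c (zn_diff n v u) * unit_root n (- j * int (zn_diff n v u)) * unit_root n (j * int v)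
        = unit_root n (j * int u) * c (zn_diff n v u)"
      by (metis mult.assoc mult.commute unit_root_add)
  qed (use n in \<open>simp_all add: zn_diff_zn_diff zn_diff_less\<close>)
  then show ?thesis by (simp add: sum_distrib_right)
qed

text \<open>Pairing \<open>A y = x y\<close> with a character \<open>\<chi>\<close>, a left eigenvector of \<open>A\<close> for the value \<open>\<mu>\<close>,
  gives \<open>x (\<chi> y) = \<mu> (\<chi> y)\<close>. Some character pairs nontrivially with \<open>y\<close>, which forces
  \<open>x = \<mu>\<close>.\<close>

lemma eigenvalue_circulant:
  assumes "eigenvalue (mat n n (\<lambda>(u, v). c (zn_diff n v u))) x"
  obtains j where "j < n" "x = (\<Sum>s<n. c s * unit_root n (- int j * int s))"
proof -
  let ?A = "mat n n (\<lambda>(u, v). c (zn_diff n v u))"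
  obtain y where y: "y \<in> carrier_vec n" "y \<noteq> 0\<^sub>v n" and Ay: "?A *\<^sub>v y = x \<cdot>\<^sub>v y"
    using assms by (auto simp: eigenvalue_def eigenvector_def)
  have dim: "dim_vec y = n" using y by simp
  have row: "(\<Sum>v<n. c (zn_diff n v u) * y $ v) = x * y $ u" if "u < n" for u
  proof -
    have "(?A *\<^sub>v y) $ u = (\<Sum>v<n. c (zn_diff n v u) * y $ v)"
      using that dim by (simp add: scalar_prod_def atLeast0LessThan)
    then show ?thesis using Ay that dim by simp
  qed
  obtain w where w: "w < n" "y $ w \<noteq> 0"
    using y dim by (metis eq_vecI index_zero_vec)
  then obtain j where j: "j < n" and nz: "(\<Sum>u<n. unit_root n (int j * int u) * y $ u) \<noteq> 0"
    using dft_eq_zero_imp_zero[of w n "\<lambda>u. y $ u"] by blast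
  let ?\<mu> = "\<Sum>s<n. c s * unit_root n (- int j * int s)"
  let ?F = "\<Sum>u<n. unit_root n (int j * int u) * y $ u"
  have "x * ?F = (\<Sum>u<n. unit_root n (int j * int u) * (x * y $ u))"
    by (simp add: sum_distrib_left mult_ac)
  also have "\<dots> = (\<Sum>u<n. unit_root n (int j * int u) * (\<Sum>v<n. c (zn_diff n v u) * y $ v))"
    by (intro sum.cong) (simp_all add: row)
  also have "\<dots> = (\<Sum>v<n. (\<Sum>u<n. unit_root n (int j * int u) * c (zn_diff n v u)) * y $ v)"
    by (simp only: sum_distrib_left sum_distrib_right mult.assoc) (rule sum.swap)
  also have "\<dots> = (\<Sum>v<n. ?\<mu> * unit_root n (int j * int v) * y $ v)"
    by (intro sum.cong) (simp_all add: circulant_left_eigenvector)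
  also have "\<dots> = ?\<mu> * ?F"
    by (simp add: sum_distrib_left mult_ac)
  finally have "x = ?\<mu>" using nz by simp
  with j show ?thesis by (rule that)
qed

section \<open>Connection sets built from gcd classes\<close>

definition HS_symbol :: "nat \<Rightarrow> nat set \<Rightarrow> nat \<Rightarrow> complex" where
  "HS_symbol n S s =
    (if s \<in> S \<and> zn_neg n s \<in> S then 1
     else if s \<in> S then (1 + \<i> * complex_of_real (sqrt 3)) / 2
     else if zn_neg n s \<in> S then (1 - \<i> * complex_of_real (sqrt 3)) / 2
     else 0)"

lemma zn_neg_zn_diff: "n > 0 \<Longrightarrow> zn_neg n (zn_diff n b a) = zn_diff n a b"
  by (simp add: zn_neg_def zn_diff_def mod_simps)

lemma HS_matrix_circ:
  "HS_matrix (circ n S) = mat n n (\<lambda>(u, v). HS_symbol n S (zn_diff n v u))"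
  by (rule eq_matI) (auto simp: HS_matrix_def circ_def HS_symbol_def zn_neg_zn_diff)

text \<open>The matrix entries are sixth roots of unity; their negatives are cube roots of unity,
  hence values of a character of any cyclic group whose order is divisible by 3.\<close>

lemma minus_unit_root_3:
  "- unit_root 3 (- 1) = (1 + \<i> * complex_of_real (sqrt 3)) / 2"
  "- unit_root 3 1 = (1 - \<i> * complex_of_real (sqrt 3)) / 2"
  by (simp_all add: unit_root_def complex_eq_iff cos_120 sin_120)

lemma cong_3_complement:
  fixes k m r :: nat
  assumes "3 dvd m" "k \<le> m"
  shows "[m - k = r] (mod 3) \<longleftrightarrow> [int k = - int r] (mod 3)"
proof -
  have "[m - k = r] (mod 3) \<longleftrightarrow> 3 dvd int m - (int k + int r)"
    using assms(2) by (simp add: cong_iff_dvd_diff of_nat_diff algebra_simps flip: cong_int_iff)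
  also have "\<dots> \<longleftrightarrow> 3 dvd int k + int r"
  proof (rule dvd_diff_right_iff)
    show "3 dvd int m" using assms(1) by presburger
  qed
  finally show ?thesis by (simp add: cong_iff_dvd_diff)
qed

lemma cong_3_opposite_iff:
  fixes k r :: nat
  assumes "r \<in> {1, 2}" "\<not> 3 dvd k"
  shows "[int k = - int r] (mod 3) \<longleftrightarrow> \<not> [k = r] (mod 3)"
proof -
  have "k mod 3 = 1 \<or> k mod 3 = 2" using assms(2) by presburger
  moreover have "int k mod 3 = int (k mod 3)" by (simp add: zmod_int)
  ultimately show ?thesis
    using assms(1) by (auto simp: cong_def)
qed

text \<open>From here on, \<open>D\<close> is the set of chosen divisors and \<open>r\<close> records the residue modulo 3
  that is chosen for each of them. An empty \<open>D\<close> covers the case of an empty connection set for any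
  \<open>n\<close>.\<close>

context
  fixes n :: nat and D :: "nat set" and r :: "nat \<Rightarrow> nat" and S :: "nat set"
  assumes n: "n > 0"
    and D: "\<And>d. d \<in> D \<Longrightarrow> 3 * d dvd n"
    and r: "\<And>d. d \<in> D \<Longrightarrow> r d \<in> {1, 2}"
    and S: "S = (\<Union>d\<in>D. G3 n (r d) d)"
begin

text \<open>Each element \<open>s\<close> of a gcd class determines its divisor as \<open>gcd s n\<close>, so the classes are
  disjoint and only the residue chosen for that one divisor matters.\<close>

lemma mem_connection_set_iff:
  assumes "s < n"
  shows "s \<in> S \<longleftrightarrow> gcd s n \<in> D \<and> [s div gcd s n = r (gcd s n)] (mod 3)"
proof
  assume "s \<in> S"
  then obtain d k where "d \<in> D" "s = d * k" "gcd (d * k) n = d" "[k = r d] (mod 3)"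
    by (auto simp: S G3_def)
  moreover from this have "d > 0" using n D by (metis gcd_eq_0_iff gr0I less_irrefl)
  ultimately show "gcd s n \<in> D \<and> [s div gcd s n = r (gcd s n)] (mod 3)" by simp
next
  assume *: "gcd s n \<in> D \<and> [s div gcd s n = r (gcd s n)] (mod 3)"
  \<comment> \<open>\<open>gcd 0 n = n\<close>, and \<open>n\<close> itself is not in \<open>D\<close> because \<open>3 * n\<close> does not divide \<open>n\<close>.\<close>
  have "s \<noteq> 0" using * n D[of n] by (cases "s = 0") (auto dest: dvd_imp_le)
  moreover have "s = gcd s n * (s div gcd s n)" by simp
  ultimately have "s \<in> G3 n (r (gcd s n)) (gcd s n)"
    using * assms unfolding G3_def
    by (intro CollectI exI[of _ "s div gcd s n"]) (simp add: Suc_le_eq)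
  then show "s \<in> S" using * S by blast
qed

text \<open>The cofactor \<open>s div gcd s n\<close> is prime to \<open>n div gcd s n\<close>, which is a multiple of 3.\<close>

lemma not_3_dvd_cofactor:
  assumes "gcd s n \<in> D"
  shows "\<not> 3 dvd s div gcd s n"
proof
  assume "3 dvd s div gcd s n"
  moreover have "3 dvd n div gcd s n"
    using D[OF assms] n by (metis dvd_div_iff_mult gcd_dvd2 gcd_eq_0_iff less_irrefl)
  moreover have "coprime (s div gcd s n) (n div gcd s n)"
    using n by (intro div_gcd_coprime) simp
  ultimately show False
    by (metis coprime_common_divisor_nat numeral_eq_one_iff semiring_norm(86))
qed

text \<open>Negation keeps the gcd class and replaces the cofactor \<open>k\<close> by \<open>m - k\<close>, where 3 divides
  \<open>m = n div gcd s n\<close>; so it negates the residue of \<open>k\<close> modulo 3.\<close>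

lemma zn_neg_mem_connection_set_iff:
  assumes "s < n"
  shows "zn_neg n s \<in> S \<longleftrightarrow>
    gcd s n \<in> D \<and> [int (s div gcd s n) = - int (r (gcd s n))] (mod 3)"
proof (cases "s = 0")
  case True
  then show ?thesis
    using mem_connection_set_iff[OF assms] n not_3_dvd_cofactor[of s] D[of n]
    by (auto simp: zn_neg_def dest: dvd_imp_le)
next
  case False
  then have neg: "zn_neg n s = n - s"
    using assms by (simp add: zn_neg_def zmod_zminus1_eq_if of_nat_diff nat_diff_distrib')
  let ?d = "gcd s n"
  have gcd: "gcd (n - s) n = ?d"
    using assms by (metis gcd.commute gcd_diff2_nat less_imp_le)
  have "[(n - s) div ?d = r ?d] (mod 3) \<longleftrightarrow> [int (s div ?d) = - int (r ?d)] (mod 3)"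
    if "?d \<in> D"
  proof -
    have "3 dvd n div ?d"
      using D[OF that] n by (metis dvd_div_iff_mult gcd_dvd2 gcd_eq_0_iff less_irrefl)
    moreover have "(n - s) div ?d = n div ?d - s div ?d"
      using assms by (metis div_add dvd_diff_nat gcd_dvd1 gcd_dvd2 add_diff_cancel_right'
          le_add_diff_inverse2 less_imp_le)
    moreover have "s div ?d \<le> n div ?d"
      using assms by (intro div_le_mono) simp
    ultimately show ?thesis
      by (simp add: cong_3_complement)
  qed
  then show ?thesis
    using mem_connection_set_iff[of "n - s"] False assms by (auto simp: neg gcd)
qed

lemma connection_set_oriented: "circ_oriented n S"
  unfolding circ_oriented_def
proof (intro ballI notI)
  fix s assume s: "s \<in> S" and neg: "zn_neg n s \<in> S"
  have "s < n" using s n by (auto simp: S G3_def)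
  then show False
    using s neg cong_3_opposite_iff[OF r not_3_dvd_cofactor]
    by (simp add: mem_connection_set_iff zn_neg_mem_connection_set_iff)
qed

text \<open>The three-way case distinction of the symbol becomes a character on each gcd class, because
  \<open>r\<^sup>2\<close> is congruent to 1 modulo 3: the exponent \<open>- r k\<close> is \<open>- 1\<close> if \<open>k\<close> is congruent to \<open>r\<close>, and
  \<open>1\<close> if \<open>k\<close> is congruent to \<open>- r\<close>.\<close>

lemma HS_symbol_eq:
  assumes "s < n"
  shows "HS_symbol n S s =
    (if gcd s n \<in> D then - unit_root 3 (- int (r (gcd s n)) * int (s div gcd s n)) else 0)"
proof (cases "gcd s n \<in> D")
  case False
  then show ?thesis
    using assms by (simp add: HS_symbol_def mem_connection_set_iff zn_neg_mem_connection_set_iff)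
next
  case True
  let ?k = "s div gcd s n" and ?r = "r (gcd s n)"
  note opposite = cong_3_opposite_iff[OF r[OF True] not_3_dvd_cofactor[OF True]]
  show ?thesis
  proof (cases "[?k = ?r] (mod 3)")
    case same: True
    then have opp: "\<not> [int ?k = - int ?r] (mod 3)"
      by (simp add: opposite)
    have "[- int ?r * int ?k = - int ?r * int ?r] (mod 3)"
      using same by (intro cong_mult) (simp_all flip: cong_int_iff)
    also have "[- int ?r * int ?r = - 1] (mod 3)"
      using r[OF True] by (auto simp: cong_def)
    finally have "unit_root 3 (- int ?r * int ?k) = unit_root 3 (- 1)"
      by (intro unit_root_cong) simp_all
    then show ?thesis
      using True same opp assms
      by (simp add: HS_symbol_def mem_connection_set_iff zn_neg_mem_connection_set_iff
          flip: minus_unit_root_3)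
  next
    case diff: False
    then have opp: "[int ?k = - int ?r] (mod 3)"
      by (simp add: opposite)
    then have "[- int ?r * int ?k = - int ?r * (- int ?r)] (mod 3)"
      by (intro cong_mult) simp_all
    also have "[- int ?r * (- int ?r) = 1] (mod 3)"
      using r[OF True] by (auto simp: cong_def)
    finally have "unit_root 3 (- int ?r * int ?k) = unit_root 3 1"
      by (intro unit_root_cong) simp_all
    then show ?thesis
      using True diff opp assms
      by (simp add: HS_symbol_def mem_connection_set_iff zn_neg_mem_connection_set_iff
          flip: minus_unit_root_3)
  qed
qed

text \<open>On the gcd class of \<open>d\<close>, with \<open>m = n div d\<close>, the cubic character is the character
  of \<open>\<int>\<^sub>m\<close> of frequency \<open>m div 3\<close>, so multiplying it into the character of frequency \<open>j\<close> shifts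
  the frequency to \<open>j - r (m div 3)\<close>.\<close>

lemma HS_symbol_fourier_coefficient:
  "(\<Sum>s<n. HS_symbol n S s * unit_root n (j * int s))
    = - (\<Sum>d\<in>D. ramanujan_sum (n div d) (j - int (r d) * int (n div d div 3)))"
proof -
  let ?f = "\<lambda>s. HS_symbol n S s * unit_root n (j * int s)"
  have D_dvd: "d dvd n" if "d \<in> D" for d
    using D[OF that] dvd_mult_right by blast
  have fin: "finite D"
    using n D_dvd by (intro finite_subset[OF _ finite_divisors_nat[of n]]) auto
  have gcd_class: "(\<Sum>s | s < n \<and> gcd s n = d. ?f s)
      = - ramanujan_sum (n div d) (j - int (r d) * int (n div d div 3))" if d: "d \<in> D" for d
  proof -
    let ?m = "n div d"
    have dn: "d dvd n" and d0: "d > 0"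
      using D_dvd[OF d] n by (auto intro: dvd_pos_nat)
    have m: "3 dvd ?m" "?m > 0"
      using D[OF d] d0 dn n by (auto simp: dvd_div_iff_mult dvd_imp_le div_greater_zero_iff)
    have summand: "?f s = - unit_root ?m ((j - int (r d) * int (?m div 3)) * int (s div d))"
      if s: "s < n" "gcd s n = d" for s
    proof -
      have "s = d * (s div d)" using s by auto
      then have "unit_root n (j * int s) = unit_root n (int d * (j * int (s div d)))"
        by (metis mult.left_commute of_nat_mult)
      also have "\<dots> = unit_root ?m (j * int (s div d))"
        by (rule unit_root_cancel[OF d0 dn])
      finally have 1: "unit_root n (j * int s) = unit_root ?m (j * int (s div d))" .
      have "?m div (?m div 3) = 3" "?m div 3 > 0" "?m div 3 dvd ?m"
        using m by (auto elim!: dvdE)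
      then have 2: "unit_root 3 (- int (r d) * int (s div d))
          = unit_root ?m (int (?m div 3) * (- int (r d) * int (s div d)))"
        using unit_root_cancel[of "?m div 3" ?m "- int (r d) * int (s div d)"] by simp
      have "?f s = - (unit_root 3 (- int (r d) * int (s div d)) * unit_root n (j * int s))"
        using s d by (simp add: HS_symbol_eq)
      also have "\<dots> = - unit_root ?m (int (?m div 3) * (- int (r d) * int (s div d)) + j * int (s div d))"
        by (simp only: 1 2 unit_root_add)
      finally show ?thesis
        by (simp add: algebra_simps)
    qed
    have "(\<Sum>s | s < n \<and> gcd s n = d. ?f s)
        = (\<Sum>s | s < n \<and> gcd s n = d. - unit_root ?m ((j - int (r d) * int (?m div 3)) * int (s div d)))"
      by (intro sum.cong) (simp_all add: summand)
    then show ?thesis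
      using n dn d0 by (simp add: sum_gcd_class ramanujan_sum_def sum_negf)
  qed
  have "(\<Sum>s<n. ?f s) = (\<Sum>s | s \<in> {..<n} \<and> gcd s n \<in> D. ?f s)"
    by (intro sum.mono_neutral_right) (auto simp: HS_symbol_eq)
  also have "\<dots> = (\<Sum>d\<in>D. \<Sum>s | s \<in> {s. s \<in> {..<n} \<and> gcd s n \<in> D} \<and> gcd s n = d. ?f s)"
    using fin by (intro sum.group[symmetric]) auto
  also have "\<dots> = (\<Sum>d\<in>D. \<Sum>s | s < n \<and> gcd s n = d. ?f s)"
    by (intro sum.cong) auto
  finally show ?thesis
    by (simp add: gcd_class sum_negf)
qed

lemma connection_set_HS_integral: "HS_integral (circ n S)"
  unfolding HS_integral_def HS_matrix_circ
proof (intro allI impI)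
  fix x assume "eigenvalue (mat n n (\<lambda>(u, v). HS_symbol n S (zn_diff n v u))) x"
  then obtain j where "x = (\<Sum>s<n. HS_symbol n S s * unit_root n (- int j * int s))"
    by (rule eigenvalue_circulant)
  then have x: "x = - (\<Sum>d\<in>D. ramanujan_sum (n div d) (- int j - int (r d) * int (n div d div 3)))"
    by (simp only: HS_symbol_fourier_coefficient)
  have "n div d > 0" if "d \<in> D" for d
    using D[OF that] n by (metis div_greater_zero_iff dvd_imp_le dvd_mult_right dvd_pos_nat)
  then show "x \<in> \<int>"
    unfolding x by (intro Ints_minus Ints_sum ramanujan_sum_in_Ints)
qed

end

theorem theorem3p9:
  fixes n :: nat and S :: "nat set"
  assumes "n \<ge> 2"
    and "S \<subseteq> {0..<n}"
    and "\<not> [n = 0] (mod 3) \<Longrightarrow> S = {}"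
    and "[n = 0] (mod 3) \<Longrightarrow>
           \<exists>(D :: nat set) (Sn :: nat \<Rightarrow> nat set).
             D \<subseteq> {d. d dvd n div 3} \<and>
             (\<forall>d\<in>D. Sn d \<in> {G3 n 1 d, G3 n 2 d}) \<and>
             S = (\<Union>d\<in>D. Sn d)"
  shows "circ_oriented n S \<and> HS_integral (circ n S)"
proof (cases "[n = 0] (mod 3)")
  case False
  then have "S = (\<Union>d\<in>{}. G3 n 1 d)"
    using assms(3) by simp
  from connection_set_oriented[OF _ _ _ this] connection_set_HS_integral[OF _ _ _ this]
  show ?thesis using assms(1) by simp
next
  case True
  then obtain D Sn where D: "D \<subseteq> {d. d dvd n div 3}"
    and Sn: "\<forall>d\<in>D. Sn d \<in> {G3 n 1 d, G3 n 2 d}" and S: "S = (\<Union>d\<in>D. Sn d)"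
    using assms(4) by blast
  define r where "r d = (if Sn d = G3 n 1 d then 1 else 2 :: nat)" for d
  have "S = (\<Union>d\<in>D. G3 n (r d) d)"
    unfolding S using Sn by (intro SUP_cong) (auto simp: r_def)
  moreover have "3 * d dvd n" if "d \<in> D" for d
  proof -
    have "3 dvd n" using True by (simp add: cong_0_iff)
    moreover have "d dvd n div 3" using D that by blast
    ultimately show ?thesis by (metis dvd_div_iff_mult mult.commute zero_neq_numeral)
  qed
  moreover have "r d \<in> {1, 2}" for d by (simp add: r_def)
  moreover have "n > 0" using assms(1) by simp
  ultimately show ?thesis
    using connection_set_oriented[of n D r S] connection_set_HS_integral[of n D r S] by blast
qed

end
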